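(* Let $R$ be a ring, let $M$ be a CS-Rickart right $R$-module and let $S=\mathrm{End}_R(M)$. Then the following statements hold: \begin{itemize} \item[(1)] If $e^2=e\in S$ and $f^2=f\in S$, then there exists $g^2=g\in S$ such that $eM\cap fM\unlhd gM$. \item[(2)] If $A,B$ are submodules of $M$ with $A\unlhd eM$ and $B\unlhd fM$ for some $e^2=e\in S$ and $f^2=f\in S$, then there exists $g^2=g\in S$ such that $A\cap B\unlhd gM$. \item[(3)] For arbitrary $\varphi_1,\ldots,\varphi_n\in S$, there exists an idempotent $e\in S$ such that $\bigcap_{1\leq i\leq n}\mathrm{Ker}\,\varphi_i\unlhd eM$. \item[(4)] $M$ is an SIP-CS module. \end{itemize}
   Context: All rings are associative with nonzero identity; modules are unitary right modules. $N\unlhd M$ means $N$ is an essential submodule of $M$. A module $M$ is CS-Rickart if for every $\varphi\in\mathrm{End}_R(M)$, $\mathrm{Ker}\,\varphi$ is essential in a direct summand of $M$. A module $M$ is an SIP-CS module if the intersection of any two direct summands of $M$ is essential in a direct summand of $M$. *)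

theory Defs
  imports "HOL-Algebra.Module" "HOL-Algebra.AbelCoset"
begin

text \<open>
  The library's \<open>module\<close> locale requires a commutative ring of scalars, so unitary right modules
  over an arbitrary ring are introduced here. The record type \<open>module\<close> is reused: the operation
  written \<open>a \<odot> x\<close> there is the right action \<open>x a\<close>. The side of the action only shows in
  \<open>rsmult_assoc\<close>, which reads \<open>x (a b) = (x a) b\<close>. The locale \<open>submodule\<close> of the library involves
  neither the side of the action nor commutativity and is used unchanged.
\<close>

locale right_module = R?: ring R + M?: abelian_group M
  for R (structure) and M :: "('a, 'b, 'c) module_scheme" (structure) +
  assumes rsmult_closed:
      "\<lbrakk>a \<in> carrier R; x \<in> carrier M\<rbrakk> \<Longrightarrow> a \<odot>\<^bsub>M\<^esub> x \<in> carrier M"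
    and rsmult_l_distr:
      "\<lbrakk>a \<in> carrier R; b \<in> carrier R; x \<in> carrier M\<rbrakk> \<Longrightarrow>
        (a \<oplus>\<^bsub>R\<^esub> b) \<odot>\<^bsub>M\<^esub> x = a \<odot>\<^bsub>M\<^esub> x \<oplus>\<^bsub>M\<^esub> b \<odot>\<^bsub>M\<^esub> x"
    and rsmult_r_distr:
      "\<lbrakk>a \<in> carrier R; x \<in> carrier M; y \<in> carrier M\<rbrakk> \<Longrightarrow>
        a \<odot>\<^bsub>M\<^esub> (x \<oplus>\<^bsub>M\<^esub> y) = a \<odot>\<^bsub>M\<^esub> x \<oplus>\<^bsub>M\<^esub> a \<odot>\<^bsub>M\<^esub> y"
    and rsmult_assoc:
      "\<lbrakk>a \<in> carrier R; b \<in> carrier R; x \<in> carrier M\<rbrakk> \<Longrightarrow>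
        (a \<otimes>\<^bsub>R\<^esub> b) \<odot>\<^bsub>M\<^esub> x = b \<odot>\<^bsub>M\<^esub> (a \<odot>\<^bsub>M\<^esub> x)"
    and rsmult_one:
      "x \<in> carrier M \<Longrightarrow> \<one>\<^bsub>R\<^esub> \<odot>\<^bsub>M\<^esub> x = x"

lemma module_imp_right_module:
  assumes "module R M"
  shows "right_module R M"
proof -
  interpret module R M by (rule assms)
  show ?thesis
    by (unfold_locales)
      (auto simp: smult_l_distr smult_r_distr smult_assoc1[symmetric] R.m_comm)
qed

text \<open>
  Endomorphisms act on the left of \<open>M\<close>. They are normalised to be \<open>undefined\<close> outside
  \<open>carrier M\<close>, so that equality in the endomorphism ring is equality of maps on \<open>M\<close>.
\<close>

definition module_End ::
  "('a, 'x) ring_scheme \<Rightarrow> ('a, 'b, 'c) module_scheme \<Rightarrow> ('b \<Rightarrow> 'b) ring" where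
  "module_End R M =
    \<lparr>carrier = {\<phi> \<in> hom (add_monoid M) (add_monoid M) \<inter> extensional (carrier M).
        \<forall>a\<in>carrier R. \<forall>x\<in>carrier M. \<phi> (a \<odot>\<^bsub>M\<^esub> x) = a \<odot>\<^bsub>M\<^esub> \<phi> x},
     mult = compose (carrier M),
     one = (\<lambda>x\<in>carrier M. x),
     zero = (\<lambda>x\<in>carrier M. \<zero>\<^bsub>M\<^esub>),
     add = (\<lambda>\<phi> \<psi>. \<lambda>x\<in>carrier M. \<phi> x \<oplus>\<^bsub>M\<^esub> \<psi> x)\<rparr>"

text \<open>\<open>essential R M N K\<close>: for submodules \<open>N\<close>, \<open>K\<close> of \<open>M\<close>, the module \<open>N\<close> is an essential
  submodule of \<open>K\<close>.\<close>

definition essential ::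
  "('a, 'x) ring_scheme \<Rightarrow> ('a, 'b, 'c) module_scheme \<Rightarrow> 'b set \<Rightarrow> 'b set \<Rightarrow> bool" where
  "essential R M N K \<longleftrightarrow>
    submodule N R M \<and> submodule K R M \<and> N \<subseteq> K \<and>
    (\<forall>L. submodule L R M \<and> L \<subseteq> K \<and> N \<inter> L = {\<zero>\<^bsub>M\<^esub>} \<longrightarrow> L = {\<zero>\<^bsub>M\<^esub>})"

definition direct_summand ::
  "('a, 'x) ring_scheme \<Rightarrow> ('a, 'b, 'c) module_scheme \<Rightarrow> 'b set \<Rightarrow> bool" where
  "direct_summand R M D \<longleftrightarrow>
    submodule D R M \<and>
    (\<exists>D'. submodule D' R M \<and> D \<inter> D' = {\<zero>\<^bsub>M\<^esub>} \<and> D <+>\<^bsub>M\<^esub> D' = carrier M)"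

definition CS_Rickart :: "('a, 'x) ring_scheme \<Rightarrow> ('a, 'b, 'c) module_scheme \<Rightarrow> bool" where
  "CS_Rickart R M \<longleftrightarrow>
    (\<forall>\<phi>\<in>carrier (module_End R M).
      \<exists>D. direct_summand R M D \<and> essential R M (a_kernel M M \<phi>) D)"

definition SIP_CS :: "('a, 'x) ring_scheme \<Rightarrow> ('a, 'b, 'c) module_scheme \<Rightarrow> bool" where
  "SIP_CS R M \<longleftrightarrow>
    (\<forall>D1 D2. direct_summand R M D1 \<and> direct_summand R M D2 \<longrightarrow>
      (\<exists>D. direct_summand R M D \<and> essential R M (D1 \<inter> D2) D))"

lemma (in right_module) rsmult_r_null:
  assumes "a \<in> carrier R" shows "a \<odot>\<^bsub>M\<^esub> \<zero>\<^bsub>M\<^esub> = \<zero>\<^bsub>M\<^esub>"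
  using rsmult_r_distr[OF assms M.zero_closed M.zero_closed] rsmult_closed[OF assms M.zero_closed]
  by (metis M.add.r_cancel_one' M.l_zero M.zero_closed)

lemma (in right_module) rsmult_r_minus:
  assumes "a \<in> carrier R" "x \<in> carrier M"
  shows "a \<odot>\<^bsub>M\<^esub> (\<ominus>\<^bsub>M\<^esub> x) = \<ominus>\<^bsub>M\<^esub> (a \<odot>\<^bsub>M\<^esub> x)"
  using assms rsmult_r_distr[of a "\<ominus>\<^bsub>M\<^esub> x" x] rsmult_r_null[of a]
  by (metis M.a_inv_closed M.l_neg M.minus_equality rsmult_closed)

lemma (in right_module) module_End_ring: "ring (module_End R M)"
proof (rule ringI)
  let ?S = "module_End R M"
  show "abelian_group ?S"
  proof (rule abelian_groupI)
    fix \<phi> assume \<phi>: "\<phi> \<in> carrier ?S"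
    let ?\<psi> = "\<lambda>x\<in>carrier M. \<ominus>\<^bsub>M\<^esub> \<phi> x"
    have "?\<psi> \<in> carrier ?S"
      using \<phi> by (auto simp: module_End_def hom_def Pi_iff M.minus_add rsmult_closed rsmult_r_minus)
    moreover have "?\<psi> \<oplus>\<^bsub>?S\<^esub> \<phi> = \<zero>\<^bsub>?S\<^esub>"
      using \<phi> by (auto simp: module_End_def hom_def Pi_iff M.l_neg intro!: restrict_ext)
    ultimately show "\<exists>\<psi>\<in>carrier ?S. \<psi> \<oplus>\<^bsub>?S\<^esub> \<phi> = \<zero>\<^bsub>?S\<^esub>" by blast
  qed (auto simp: module_End_def hom_def Pi_iff rsmult_closed rsmult_r_distr rsmult_r_null
        M.add.m_ac extensional_restrict intro!: restrict_ext extensionalityI[of _ "carrier M"])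
  show "Group.monoid ?S"
    by (rule monoidI)
      (auto simp: module_End_def hom_def Pi_iff compose_def rsmult_closed
        intro!: restrict_ext extensionalityI[of _ "carrier M"])
qed (auto simp: module_End_def hom_def Pi_iff compose_def intro!: restrict_ext)

end

theory Submission
  imports Defs
begin

text \<open>
  Everything reduces to the intersection of two images of idempotents \<open>e\<close>, \<open>f\<close>. The endomorphism
  \<open>\<phi> = (1 - f) e\<close> satisfies \<open>Ker \<phi> = (1 - e)M \<oplus> (eM \<inter> fM)\<close>, so it detects the intersection up to
  the summand \<open>(1 - e)M\<close>. Since \<open>M\<close> is CS-Rickart, \<open>Ker \<phi>\<close> is essential in a direct summand
  \<open>D = dM\<close> with \<open>d\<close> idempotent. As \<open>(1 - e)M \<subseteq> D\<close>, the complement \<open>(1 - e)M\<close> can be split off from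
  \<open>D\<close>: the map \<open>g = e d\<close> is idempotent with image \<open>D \<inter> eM\<close>, and a submodule of \<open>eM\<close> meets
  \<open>Ker \<phi>\<close> exactly where it meets \<open>eM \<inter> fM\<close>, so \<open>eM \<inter> fM\<close> is essential in \<open>gM\<close>. This is
  \<open>essential_image_Int\<close>.

  The other assertions are formal consequences. Essential extensions are transitive and compatible
  with finite intersections, which replaces \<open>eM\<close> and \<open>fM\<close> by essential submodules of them; an
  induction then treats finitely many kernels; and direct summands are exactly the images of
  idempotent endomorphisms (\<open>direct_summand_iff_image\<close>), which gives the SIP-CS property.
\<close>

section \<open>Submodules\<close>

context right_module
begin

lemma submoduleI:
  assumes "H \<subseteq> carrier M" "\<zero>\<^bsub>M\<^esub> \<in> H"
    and "\<And>x y. x \<in> H \<Longrightarrow> y \<in> H \<Longrightarrow> x \<oplus>\<^bsub>M\<^esub> y \<in> H"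
    and "\<And>x. x \<in> H \<Longrightarrow> \<ominus>\<^bsub>M\<^esub> x \<in> H"
    and "\<And>a x. a \<in> carrier R \<Longrightarrow> x \<in> H \<Longrightarrow> a \<odot>\<^bsub>M\<^esub> x \<in> H"
  shows "submodule H R M"
  using assms by (intro submodule.intro subgroup.intro) (auto simp: submodule_axioms_def a_inv_def)

lemma submoduleD:
  assumes "submodule H R M"
  shows "H \<subseteq> carrier M" "\<zero>\<^bsub>M\<^esub> \<in> H"
    and "\<And>x y. x \<in> H \<Longrightarrow> y \<in> H \<Longrightarrow> x \<oplus>\<^bsub>M\<^esub> y \<in> H"
    and "\<And>x. x \<in> H \<Longrightarrow> \<ominus>\<^bsub>M\<^esub> x \<in> H"
    and "\<And>a x. a \<in> carrier R \<Longrightarrow> x \<in> H \<Longrightarrow> a \<odot>\<^bsub>M\<^esub> x \<in> H"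
proof -
  interpret H: submodule H R M by (rule assms)
  show "H \<subseteq> carrier M" "\<zero>\<^bsub>M\<^esub> \<in> H"
    using H.subset H.one_closed by auto
  show "\<And>x y. x \<in> H \<Longrightarrow> y \<in> H \<Longrightarrow> x \<oplus>\<^bsub>M\<^esub> y \<in> H"
    using H.m_closed by simp
  show "\<And>x. x \<in> H \<Longrightarrow> \<ominus>\<^bsub>M\<^esub> x \<in> H"
    using H.m_inv_closed by (simp add: a_inv_def)
  show "\<And>a x. a \<in> carrier R \<Longrightarrow> x \<in> H \<Longrightarrow> a \<odot>\<^bsub>M\<^esub> x \<in> H"
    by (rule H.smult_closed)
qed

lemma submodule_Int:
  assumes "submodule H R M" "submodule K R M"
  shows "submodule (H \<inter> K) R M"
  using submoduleD[OF assms(1)] submoduleD[OF assms(2)] by (intro submoduleI) auto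


section \<open>Essential submodules\<close>

lemma essential_zeroD:
  assumes "essential R M N K" "submodule L R M" "L \<subseteq> K" "N \<inter> L = {\<zero>\<^bsub>M\<^esub>}"
  shows "L = {\<zero>\<^bsub>M\<^esub>}"
  using assms by (auto simp: essential_def)

lemma essential_trans:
  assumes NK: "essential R M N K" and KP: "essential R M K P"
  shows "essential R M N P"
  unfolding essential_def
proof (intro conjI allI impI)
  fix L assume L: "submodule L R M \<and> L \<subseteq> P \<and> N \<inter> L = {\<zero>\<^bsub>M\<^esub>}"
  have "N \<subseteq> K" "submodule K R M"
    using NK by (auto simp: essential_def)
  then have "N \<inter> (K \<inter> L) = {\<zero>\<^bsub>M\<^esub>}" "submodule (K \<inter> L) R M"
    using L submodule_Int by auto
  then have "K \<inter> L = {\<zero>\<^bsub>M\<^esub>}"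
    using essential_zeroD[OF NK] by auto
  then show "L = {\<zero>\<^bsub>M\<^esub>}"
    using essential_zeroD[OF KP] L by auto
qed (use assms in \<open>auto simp: essential_def\<close>)

text \<open>
  A submodule \<open>L\<close> of \<open>C \<inter> D\<close> avoiding \<open>A \<inter> B\<close> is killed in two steps: \<open>A \<inter> L\<close> lies in \<open>D\<close> and
  avoids \<open>B\<close>, hence vanishes, and then \<open>L\<close> lies in \<open>C\<close> and avoids \<open>A\<close>.
\<close>

lemma essential_Int:
  assumes AC: "essential R M A C" and BD: "essential R M B D"
  shows "essential R M (A \<inter> B) (C \<inter> D)"
  unfolding essential_def
proof (intro conjI allI impI)
  have sub: "submodule A R M" "submodule B R M" "submodule C R M" "submodule D R M"
    using assms by (auto simp: essential_def)
  show "submodule (A \<inter> B) R M" "submodule (C \<inter> D) R M"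
    using sub submodule_Int by auto
  show "A \<inter> B \<subseteq> C \<inter> D"
    using assms by (auto simp: essential_def)
  fix L assume L: "submodule L R M \<and> L \<subseteq> C \<inter> D \<and> A \<inter> B \<inter> L = {\<zero>\<^bsub>M\<^esub>}"
  then have "submodule (A \<inter> L) R M" "A \<inter> L \<subseteq> D" "B \<inter> (A \<inter> L) = {\<zero>\<^bsub>M\<^esub>}"
    using sub submodule_Int by auto
  then have "A \<inter> L = {\<zero>\<^bsub>M\<^esub>}"
    using essential_zeroD[OF BD] by auto
  then show "L = {\<zero>\<^bsub>M\<^esub>}"
    using essential_zeroD[OF AC] L by auto
qed


section \<open>Idempotent endomorphisms and direct summands\<close>

lemma module_End_iff:
  "\<phi> \<in> carrier (module_End R M) \<longleftrightarrow>
    \<phi> \<in> carrier M \<rightarrow> carrier M \<and> \<phi> \<in> extensional (carrier M) \<and>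
    (\<forall>x\<in>carrier M. \<forall>y\<in>carrier M. \<phi> (x \<oplus>\<^bsub>M\<^esub> y) = \<phi> x \<oplus>\<^bsub>M\<^esub> \<phi> y) \<and>
    (\<forall>a\<in>carrier R. \<forall>x\<in>carrier M. \<phi> (a \<odot>\<^bsub>M\<^esub> x) = a \<odot>\<^bsub>M\<^esub> \<phi> x)"
  by (auto simp: module_End_def hom_def)

lemma module_EndD:
  assumes "\<phi> \<in> carrier (module_End R M)"
  shows "\<And>x. x \<in> carrier M \<Longrightarrow> \<phi> x \<in> carrier M"
    and "\<And>x y. x \<in> carrier M \<Longrightarrow> y \<in> carrier M \<Longrightarrow> \<phi> (x \<oplus>\<^bsub>M\<^esub> y) = \<phi> x \<oplus>\<^bsub>M\<^esub> \<phi> y"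
    and "\<And>a x. a \<in> carrier R \<Longrightarrow> x \<in> carrier M \<Longrightarrow> \<phi> (a \<odot>\<^bsub>M\<^esub> x) = a \<odot>\<^bsub>M\<^esub> \<phi> x"
  using assms by (auto simp: module_End_iff)

lemma module_End_zero:
  assumes "\<phi> \<in> carrier (module_End R M)"
  shows "\<phi> \<zero>\<^bsub>M\<^esub> = \<zero>\<^bsub>M\<^esub>"
  using module_EndD(1,2)[OF assms, of "\<zero>\<^bsub>M\<^esub>"] module_EndD(2)[OF assms, of "\<zero>\<^bsub>M\<^esub>" "\<zero>\<^bsub>M\<^esub>"]
  by (metis M.add.r_cancel_one' M.l_zero M.zero_closed)

lemma module_End_minus:
  assumes "\<phi> \<in> carrier (module_End R M)" "x \<in> carrier M"
  shows "\<phi> (\<ominus>\<^bsub>M\<^esub> x) = \<ominus>\<^bsub>M\<^esub> \<phi> x"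
  using module_EndD(1)[OF assms] module_EndD(2)[OF assms(1), of "\<ominus>\<^bsub>M\<^esub> x" x]
    module_End_zero[OF assms(1)] assms module_EndD(1)[OF assms(1), of "\<ominus>\<^bsub>M\<^esub> x"]
  by (metis M.a_inv_closed M.l_neg M.minus_equality)

lemma module_End_mult_apply:
  assumes "x \<in> carrier M"
  shows "(\<phi> \<otimes>\<^bsub>module_End R M\<^esub> \<psi>) x = \<phi> (\<psi> x)"
  using assms by (simp add: module_End_def compose_def)

lemma module_End_eqI:
  assumes "\<phi> \<in> carrier (module_End R M)" "\<psi> \<in> carrier (module_End R M)"
    and "\<And>x. x \<in> carrier M \<Longrightarrow> \<phi> x = \<psi> x"
  shows "\<phi> = \<psi>"
  using assms extensionalityI[of \<phi> "carrier M" \<psi>] by (auto simp: module_End_iff)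

lemma module_End_mult_closed:
  assumes "\<phi> \<in> carrier (module_End R M)" "\<psi> \<in> carrier (module_End R M)"
  shows "\<phi> \<otimes>\<^bsub>module_End R M\<^esub> \<psi> \<in> carrier (module_End R M)"
  using ring.ring_simprules(5)[OF module_End_ring assms] .

definition idempotent_End :: "('b \<Rightarrow> 'b) \<Rightarrow> bool" where
  "idempotent_End e \<longleftrightarrow> e \<in> carrier (module_End R M) \<and> e \<otimes>\<^bsub>module_End R M\<^esub> e = e"

lemma idempotent_End_iff:
  "idempotent_End e \<longleftrightarrow> e \<in> carrier (module_End R M) \<and> (\<forall>x\<in>carrier M. e (e x) = e x)"
  unfolding idempotent_End_def
  using module_End_mult_apply[of _ e e] module_End_mult_closed[of e e]
  by (metis module_End_eqI)

lemma idempotent_End_image_iff: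
  assumes "idempotent_End e"
  shows "x \<in> e ` carrier M \<longleftrightarrow> x \<in> carrier M \<and> e x = x"
  using assms module_EndD(1)[of e] by (force simp: idempotent_End_iff)

lemma a_kernel_iff: "x \<in> a_kernel M M \<phi> \<longleftrightarrow> x \<in> carrier M \<and> \<phi> x = \<zero>\<^bsub>M\<^esub>"
  by (simp add: a_kernel_def kernel_def)

lemma submodule_kernel:
  assumes "\<phi> \<in> carrier (module_End R M)"
  shows "submodule (a_kernel M M \<phi>) R M"
  using module_EndD[OF assms] module_End_zero[OF assms] module_End_minus[OF assms]
  by (intro submoduleI) (auto simp: a_kernel_iff rsmult_closed rsmult_r_null)

lemma submodule_image:
  assumes "\<phi> \<in> carrier (module_End R M)"
  shows "submodule (\<phi> ` carrier M) R M"
proof (rule submoduleI)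
  note \<phi> = module_EndD[OF assms]
  show "\<phi> ` carrier M \<subseteq> carrier M"
    using \<phi> by auto
  show "\<zero>\<^bsub>M\<^esub> \<in> \<phi> ` carrier M"
    using module_End_zero[OF assms] M.zero_closed by (metis imageI)
  show "x \<oplus>\<^bsub>M\<^esub> y \<in> \<phi> ` carrier M" if "x \<in> \<phi> ` carrier M" "y \<in> \<phi> ` carrier M" for x y
    using that by (auto simp flip: \<phi>(2))
  show "\<ominus>\<^bsub>M\<^esub> x \<in> \<phi> ` carrier M" if "x \<in> \<phi> ` carrier M" for x
    using that by (auto simp flip: module_End_minus[OF assms])
  show "a \<odot>\<^bsub>M\<^esub> x \<in> \<phi> ` carrier M" if "a \<in> carrier R" "x \<in> \<phi> ` carrier M" for a x
    using that by (auto simp: rsmult_closed simp flip: \<phi>(3))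
qed

lemma add_minus_cancel:
  assumes "x \<in> carrier M" "y \<in> carrier M"
  shows "y \<oplus>\<^bsub>M\<^esub> (x \<ominus>\<^bsub>M\<^esub> y) = x"
  using assms M.add.m_lcomm[of y x "\<ominus>\<^bsub>M\<^esub> y"] by (simp add: M.minus_eq M.r_neg)

lemma minus_add_cancel:
  assumes "x \<in> carrier M" "y \<in> carrier M"
  shows "x \<ominus>\<^bsub>M\<^esub> (x \<ominus>\<^bsub>M\<^esub> y) = y"
  using assms by (metis M.add.inv_solve_right M.minus_closed M.minus_eq add_minus_cancel)

lemma minus_eq_zero_iff:
  assumes "x \<in> carrier M" "y \<in> carrier M"
  shows "x \<ominus>\<^bsub>M\<^esub> y = \<zero>\<^bsub>M\<^esub> \<longleftrightarrow> x = y"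
  using assms add_minus_cancel[of x y] M.r_zero[of y] by (auto simp: M.minus_eq M.r_neg)

text \<open>The kernel of an idempotent is a complement of its image, by \<open>x = e x + (x - e x)\<close>.\<close>

lemma idempotent_End_image_direct_summand:
  assumes e: "idempotent_End e"
  shows "direct_summand R M (e ` carrier M)"
proof -
  have E: "e \<in> carrier (module_End R M)" and ee: "\<And>x. x \<in> carrier M \<Longrightarrow> e (e x) = e x"
    using e by (auto simp: idempotent_End_iff)
  note eD = module_EndD[OF E]
  have "e ` carrier M \<inter> a_kernel M M e = {\<zero>\<^bsub>M\<^esub>}"
    using idempotent_End_image_iff[OF e] module_End_zero[OF E] by (auto simp: a_kernel_iff ee)
  moreover have "e ` carrier M <+>\<^bsub>M\<^esub> a_kernel M M e = carrier M"
  proof (intro equalityI subsetI)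
    fix x assume x: "x \<in> carrier M"
    have "e (x \<ominus>\<^bsub>M\<^esub> e x) = \<zero>\<^bsub>M\<^esub>"
      using x eD(1)[OF x] by (simp add: M.minus_eq eD(2) module_End_minus[OF E] ee M.r_neg)
    then have "x \<ominus>\<^bsub>M\<^esub> e x \<in> a_kernel M M e"
      using x eD by (simp add: a_kernel_iff)
    moreover have "x = e x \<oplus>\<^bsub>M\<^esub> (x \<ominus>\<^bsub>M\<^esub> e x)"
      using x eD add_minus_cancel by simp
    ultimately show "x \<in> e ` carrier M <+>\<^bsub>M\<^esub> a_kernel M M e"
      using x unfolding set_add_def' by blast
  qed (auto simp: set_add_def' a_kernel_iff eD)
  ultimately show ?thesis
    using submodule_image[OF E] submodule_kernel[OF E] unfolding direct_summand_def by blast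
qed

text \<open>Conversely, the projection along a complement is an idempotent with the summand as image.\<close>

lemma direct_summand_imp_image:
  assumes "direct_summand R M D"
  obtains e where "idempotent_End e" "e ` carrier M = D"
proof -
  obtain D' where sub: "submodule D R M" "submodule D' R M"
    and disj: "D \<inter> D' = {\<zero>\<^bsub>M\<^esub>}" and span: "D <+>\<^bsub>M\<^esub> D' = carrier M"
    using assms unfolding direct_summand_def by blast
  note D = submoduleD[OF sub(1)] and D' = submoduleD[OF sub(2)]
  have uniq: "c = d" if c: "c \<in> D" "c' \<in> D'" and d: "d \<in> D" "d' \<in> D'"
    and eq: "c \<oplus>\<^bsub>M\<^esub> c' = d \<oplus>\<^bsub>M\<^esub> d'" for c c' d d'
  proof -
    have cl: "c \<in> carrier M" "c' \<in> carrier M" "d \<in> carrier M" "d' \<in> carrier M"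
      using c d D(1) D'(1) by auto
    have "c = (d \<oplus>\<^bsub>M\<^esub> d') \<ominus>\<^bsub>M\<^esub> c'"
      using cl by (simp flip: eq add: M.minus_eq M.a_assoc M.r_neg)
    also have "\<dots> = d \<oplus>\<^bsub>M\<^esub> (d' \<ominus>\<^bsub>M\<^esub> c')"
      using cl by (simp add: M.minus_eq M.a_assoc)
    finally have c_eq: "c = d \<oplus>\<^bsub>M\<^esub> (d' \<ominus>\<^bsub>M\<^esub> c')" .
    have "\<ominus>\<^bsub>M\<^esub> d \<oplus>\<^bsub>M\<^esub> c = d' \<ominus>\<^bsub>M\<^esub> c'"
      using cl by (simp add: c_eq M.r_neg1)
    moreover have "\<ominus>\<^bsub>M\<^esub> d \<oplus>\<^bsub>M\<^esub> c \<in> D" "d' \<ominus>\<^bsub>M\<^esub> c' \<in> D'"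
      using c d D(3,4) D'(3,4) by (auto simp: M.minus_eq)
    ultimately have "d' \<ominus>\<^bsub>M\<^esub> c' = \<zero>\<^bsub>M\<^esub>"
      using disj by auto
    then show ?thesis
      using c_eq cl by simp
  qed
  define e where "e = (\<lambda>x\<in>carrier M. THE d. d \<in> D \<and> (\<exists>d'\<in>D'. x = d \<oplus>\<^bsub>M\<^esub> d'))"
  have e_add: "e (d \<oplus>\<^bsub>M\<^esub> d') = d" if "d \<in> D" "d' \<in> D'" for d d'
  proof -
    have "d \<oplus>\<^bsub>M\<^esub> d' \<in> carrier M"
      using that D(1) D'(1) by auto
    then show ?thesis
      unfolding e_def using that uniq by (auto intro!: the_equality)
  qed
  have decomp: "\<exists>d\<in>D. \<exists>d'\<in>D'. x = d \<oplus>\<^bsub>M\<^esub> d'" if "x \<in> carrier M" for x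
    using that by (auto simp flip: span simp: set_add_def')
  have E: "e \<in> carrier (module_End R M)"
    unfolding module_End_iff
  proof (intro conjI ballI)
    show "e \<in> carrier M \<rightarrow> carrier M"
      using decomp e_add D(1) by fastforce
    show "e \<in> extensional (carrier M)"
      by (simp add: e_def)
    fix x assume "x \<in> carrier M"
    then obtain d d' where x: "d \<in> D" "d' \<in> D'" "x = d \<oplus>\<^bsub>M\<^esub> d'"
      using decomp by blast
    have xcl: "d \<in> carrier M" "d' \<in> carrier M"
      using x D(1) D'(1) by auto
    show "e (a \<odot>\<^bsub>M\<^esub> x) = a \<odot>\<^bsub>M\<^esub> e x" if "a \<in> carrier R" for a
      using that x xcl D(5) D'(5) by (simp add: rsmult_r_distr e_add)
    fix y assume "y \<in> carrier M"
    then obtain c c' where y: "c \<in> D" "c' \<in> D'" "y = c \<oplus>\<^bsub>M\<^esub> c'"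
      using decomp by blast
    have ycl: "c \<in> carrier M" "c' \<in> carrier M"
      using y D(1) D'(1) by auto
    have "x \<oplus>\<^bsub>M\<^esub> y = (d \<oplus>\<^bsub>M\<^esub> c) \<oplus>\<^bsub>M\<^esub> (d' \<oplus>\<^bsub>M\<^esub> c')"
      using x y xcl ycl by (simp add: M.a_ac)
    then show "e (x \<oplus>\<^bsub>M\<^esub> y) = e x \<oplus>\<^bsub>M\<^esub> e y"
      using x y D(3) D'(3) by (simp add: e_add)
  qed
  have fix_D: "e d = d" if "d \<in> D" for d
    using e_add[OF that D'(2)] that D(1) by auto
  have in_D: "e x \<in> D" if "x \<in> carrier M" for x
    using decomp[OF that] e_add by auto
  have "e ` carrier M = D"
    using in_D fix_D D(1) by force
  moreover have "idempotent_End e"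
    using E in_D fix_D by (simp add: idempotent_End_iff)
  ultimately show thesis
    using that by blast
qed

lemma direct_summand_iff_image:
  "direct_summand R M D \<longleftrightarrow> (\<exists>e. idempotent_End e \<and> e ` carrier M = D)"
  using direct_summand_imp_image idempotent_End_image_direct_summand by metis


section \<open>Intersections in CS-Rickart modules\<close>

lemma CS_Rickart_kernel:
  assumes "CS_Rickart R M" "\<phi> \<in> carrier (module_End R M)"
  obtains e where "idempotent_End e" "essential R M (a_kernel M M \<phi>) (e ` carrier M)"
  using assms unfolding CS_Rickart_def direct_summand_iff_image by blast

text \<open>
  The submodule \<open>eM \<inter> fM\<close> is the kernel of \<open>x \<mapsto> (x - e x, x - f x)\<close>, a map into \<open>M \<oplus> M\<close>, on which
  the CS-Rickart condition says nothing. Enlarging it by \<open>(1 - e)M\<close> turns it into the kernel of the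
  single endomorphism \<open>x \<mapsto> e x - f (e x)\<close>, and composing with \<open>e\<close> afterwards removes what was added.
\<close>

lemma essential_image_Int:
  assumes cs: "CS_Rickart R M" and e: "idempotent_End e" and f: "idempotent_End f"
  obtains g where "idempotent_End g"
    "essential R M (e ` carrier M \<inter> f ` carrier M) (g ` carrier M)"
proof -
  have E: "e \<in> carrier (module_End R M)" and ee: "\<And>x. x \<in> carrier M \<Longrightarrow> e (e x) = e x"
    using e by (auto simp: idempotent_End_iff)
  have F: "f \<in> carrier (module_End R M)"
    using f by (auto simp: idempotent_End_iff)
  note eD = module_EndD[OF E] and fD = module_EndD[OF F]
  define \<phi> where "\<phi> = (\<lambda>x\<in>carrier M. e x \<ominus>\<^bsub>M\<^esub> f (e x))"
  have \<phi>: "\<phi> \<in> carrier (module_End R M)"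
    unfolding module_End_iff
    by (auto simp: \<phi>_def eD fD M.minus_eq M.minus_add M.a_ac rsmult_closed rsmult_r_distr
        rsmult_r_minus)
  have ker: "x \<in> a_kernel M M \<phi> \<longleftrightarrow> x \<in> carrier M \<and> f (e x) = e x" for x
    using eD fD minus_eq_zero_iff[of "e x" "f (e x)"] by (auto simp: a_kernel_iff \<phi>_def)
  obtain d where d: "idempotent_End d" and ess: "essential R M (a_kernel M M \<phi>) (d ` carrier M)"
    using CS_Rickart_kernel[OF cs \<phi>] .
  have Dm: "d \<in> carrier (module_End R M)"
    using d by (auto simp: idempotent_End_iff)
  note dD = module_EndD[OF Dm]
  note D = submoduleD[OF submodule_image[OF Dm]]
  \<comment> \<open>The summand \<open>dM\<close> contains \<open>(1 - e)M\<close>, so it is stable under \<open>e = 1 - (1 - e)\<close>.\<close>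
  have compl: "x \<ominus>\<^bsub>M\<^esub> e x \<in> d ` carrier M" if x: "x \<in> carrier M" for x
  proof -
    have "e (x \<ominus>\<^bsub>M\<^esub> e x) = \<zero>\<^bsub>M\<^esub>"
      using x eD(1)[OF x] by (simp add: M.minus_eq eD(2) module_End_minus[OF E] ee M.r_neg)
    then have "x \<ominus>\<^bsub>M\<^esub> e x \<in> a_kernel M M \<phi>"
      using x eD(1) module_End_zero[OF F] by (simp add: ker)
    then show ?thesis
      using ess by (auto simp: essential_def)
  qed
  have e_D: "e x \<in> d ` carrier M" if x: "x \<in> d ` carrier M" for x
  proof -
    have xM: "x \<in> carrier M"
      using x D(1) by auto
    have "x \<ominus>\<^bsub>M\<^esub> (x \<ominus>\<^bsub>M\<^esub> e x) \<in> d ` carrier M"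
      using x compl[OF xM] D(3,4) by (simp add: M.minus_eq)
    then show ?thesis
      using xM eD(1) minus_add_cancel by simp
  qed
  define g where "g = e \<otimes>\<^bsub>module_End R M\<^esub> d"
  have g_apply: "g x = e (d x)" if "x \<in> carrier M" for x
    using that by (simp add: g_def module_End_mult_apply)
  have ed: "d (e (d x)) = e (d x)" if "x \<in> carrier M" for x
    using e_D[of "d x"] that idempotent_End_image_iff[OF d] by auto
  have g: "idempotent_End g"
    unfolding idempotent_End_iff
    using module_End_mult_closed[OF E Dm] by (auto simp: g_def[symmetric] g_apply ed ee eD dD)
  have gM: "g ` carrier M = e ` carrier M \<inter> d ` carrier M"
  proof
    show "g ` carrier M \<subseteq> e ` carrier M \<inter> d ` carrier M"
      using e_D by (auto simp: g_apply dD)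
    show "e ` carrier M \<inter> d ` carrier M \<subseteq> g ` carrier M"
    proof
      fix x assume "x \<in> e ` carrier M \<inter> d ` carrier M"
      then have "x \<in> carrier M" "e x = x" "d x = x"
        using idempotent_End_image_iff[OF d, of x] idempotent_End_image_iff[OF e, of x] by auto
      then show "x \<in> g ` carrier M"
        using idempotent_End_image_iff[OF g, of x] g_apply[of x] by simp
    qed
  qed
  have "essential R M (e ` carrier M \<inter> f ` carrier M) (g ` carrier M)"
    unfolding essential_def
  proof (intro conjI allI impI)
    show "submodule (e ` carrier M \<inter> f ` carrier M) R M"
      using submodule_image E F submodule_Int by auto
    show "submodule (g ` carrier M) R M"
      using submodule_image g by (auto simp: idempotent_End_iff)
    have int_ker: "x \<in> a_kernel M M \<phi> \<longleftrightarrow> x \<in> f ` carrier M" if "x \<in> e ` carrier M" for x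
      using that idempotent_End_image_iff[OF e] idempotent_End_image_iff[OF f] by (auto simp: ker)
    then show "e ` carrier M \<inter> f ` carrier M \<subseteq> g ` carrier M"
      using ess unfolding gM essential_def by blast
    fix L assume L: "submodule L R M \<and> L \<subseteq> g ` carrier M \<and>
      e ` carrier M \<inter> f ` carrier M \<inter> L = {\<zero>\<^bsub>M\<^esub>}"
    then have "a_kernel M M \<phi> \<inter> L = {\<zero>\<^bsub>M\<^esub>}"
      using int_ker unfolding gM by blast
    then show "L = {\<zero>\<^bsub>M\<^esub>}"
      using essential_zeroD[OF ess] L unfolding gM by blast
  qed
  then show thesis
    using that g by blast
qed

lemma essential_in_image_Int:
  assumes "CS_Rickart R M" "idempotent_End e" "idempotent_End f"
    and "essential R M A (e ` carrier M)" "essential R M B (f ` carrier M)"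
  obtains g where "idempotent_End g" "essential R M (A \<inter> B) (g ` carrier M)"
  using essential_image_Int[OF assms(1-3)] essential_trans[OF essential_Int[OF assms(4,5)]] by metis

lemma essential_INT_kernel:
  assumes cs: "CS_Rickart R M" and "finite I" "I \<noteq> {}"
    and "\<And>i. i \<in> I \<Longrightarrow> \<phi> i \<in> carrier (module_End R M)"
  shows "\<exists>e. idempotent_End e \<and> essential R M (\<Inter>i\<in>I. a_kernel M M (\<phi> i)) (e ` carrier M)"
  using assms(2-)
proof (induction I rule: finite_ne_induct)
  case (singleton i)
  then show ?case
    using CS_Rickart_kernel[OF cs, of "\<phi> i"] by auto
next
  case (insert i I)
  then obtain e where e: "idempotent_End e"
    "essential R M (\<Inter>i\<in>I. a_kernel M M (\<phi> i)) (e ` carrier M)"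
    by auto
  obtain f where f: "idempotent_End f" "essential R M (a_kernel M M (\<phi> i)) (f ` carrier M)"
    using CS_Rickart_kernel[OF cs, of "\<phi> i"] insert.prems by auto
  show ?case
    using essential_in_image_Int[OF cs f(1) e(1) f(2) e(2)] by auto
qed

lemma CS_Rickart_imp_SIP_CS:
  assumes "CS_Rickart R M"
  shows "SIP_CS R M"
  unfolding SIP_CS_def direct_summand_iff_image
  using essential_image_Int[OF assms] by metis

end

theorem proposition2p9:
  fixes R :: "('a, 'x) ring_scheme"
    and M :: "('a, 'b, 'c) module_scheme"
    and S :: "('b \<Rightarrow> 'b) ring"
  assumes "right_module R M"
    and "\<one>\<^bsub>R\<^esub> \<noteq> \<zero>\<^bsub>R\<^esub>"
    and "CS_Rickart R M"
    and S: "S = module_End R M"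
  shows
    "(\<forall>e\<in>carrier S. \<forall>f\<in>carrier S. e \<otimes>\<^bsub>S\<^esub> e = e \<and> f \<otimes>\<^bsub>S\<^esub> f = f \<longrightarrow>
        (\<exists>g\<in>carrier S. g \<otimes>\<^bsub>S\<^esub> g = g \<and>
          essential R M (e ` carrier M \<inter> f ` carrier M) (g ` carrier M)))
   \<and> (\<forall>A B. submodule A R M \<and> submodule B R M \<and>
        (\<exists>e\<in>carrier S. e \<otimes>\<^bsub>S\<^esub> e = e \<and> essential R M A (e ` carrier M)) \<and>
        (\<exists>f\<in>carrier S. f \<otimes>\<^bsub>S\<^esub> f = f \<and> essential R M B (f ` carrier M)) \<longrightarrow>
        (\<exists>g\<in>carrier S. g \<otimes>\<^bsub>S\<^esub> g = g \<and> essential R M (A \<inter> B) (g ` carrier M)))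
   \<and> (\<forall>(n::nat) \<phi>. n \<ge> 1 \<and> (\<forall>i\<in>{1..n}. \<phi> i \<in> carrier S) \<longrightarrow>
        (\<exists>e\<in>carrier S. e \<otimes>\<^bsub>S\<^esub> e = e \<and>
          essential R M (\<Inter>i\<in>{1..n}. a_kernel M M (\<phi> i)) (e ` carrier M)))
   \<and> SIP_CS R M"
proof -
  interpret right_module R M by (rule assms(1))
  note cs = assms(3)
  have idem: "idempotent_End e \<longleftrightarrow> e \<in> carrier S \<and> e \<otimes>\<^bsub>S\<^esub> e = e" for e
    by (simp add: idempotent_End_def S)
  show ?thesis
  proof (intro conjI allI ballI impI)
    fix e f assume "e \<in> carrier S" "f \<in> carrier S" "e \<otimes>\<^bsub>S\<^esub> e = e \<and> f \<otimes>\<^bsub>S\<^esub> f = f"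
    then show "\<exists>g\<in>carrier S. g \<otimes>\<^bsub>S\<^esub> g = g \<and>
        essential R M (e ` carrier M \<inter> f ` carrier M) (g ` carrier M)"
      using essential_image_Int[OF cs] idem by metis
  next
    fix A B
    assume "submodule A R M \<and> submodule B R M \<and>
      (\<exists>e\<in>carrier S. e \<otimes>\<^bsub>S\<^esub> e = e \<and> essential R M A (e ` carrier M)) \<and>
      (\<exists>f\<in>carrier S. f \<otimes>\<^bsub>S\<^esub> f = f \<and> essential R M B (f ` carrier M))"
    then show "\<exists>g\<in>carrier S. g \<otimes>\<^bsub>S\<^esub> g = g \<and> essential R M (A \<inter> B) (g ` carrier M)"
      using essential_in_image_Int[OF cs] idem by metis
  next
    fix n :: nat and \<phi>
    assume "n \<ge> 1 \<and> (\<forall>i\<in>{1..n}. \<phi> i \<in> carrier S)"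
    then show "\<exists>e\<in>carrier S. e \<otimes>\<^bsub>S\<^esub> e = e \<and>
        essential R M (\<Inter>i\<in>{1..n}. a_kernel M M (\<phi> i)) (e ` carrier M)"
      using essential_INT_kernel[OF cs, of "{1..n}" \<phi>] idem S by auto
  next
    show "SIP_CS R M"
      by (rule CS_Rickart_imp_SIP_CS[OF cs])
  qed
qed

end
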